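(* Let $R$ be a non-commutative finite ring and let $p$ be the smallest prime dividing the order of $R$. If $d(R) = \frac{1}{p^3}(p^2 + p - 1)$, then $|\operatorname{Cent}(R)| = p + 2$.
   Context: Rings are associative and not assumed to have a unity. For $r \in R$, the centralizer of $r$ is the subring $C(r) = \{s \in R : rs = sr\}$, and $\operatorname{Cent}(R) = \{C(r) : r \in R\}$ is the set of all distinct centralizers. The commutativity degree of a finite ring $R$ is $d(R) = \frac{1}{|R|^2}\sum_{r \in R} |C(r)|$, i.e. the probability that a randomly chosen pair of elements of $R$ commutes. *)

theory Defs
  imports Complex_Main "HOL-Library.Cardinality" "HOL-Computational_Algebra.Primes"
begin

text \<open>
  The ring \<open>R\<close> is a type of class \<^class>\<open>ring\<close>, i.e. an associative ring in which no
  multiplicative unit is assumed.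
\<close>

definition centralizer :: "'a::ring \<Rightarrow> 'a set" where
  "centralizer r = {s. r * s = s * r}"

definition Cent :: "'a::ring itself \<Rightarrow> 'a set set" where
  "Cent _ = range centralizer"

definition commutativity_degree :: "'a::{ring, finite} itself \<Rightarrow> real" where
  "commutativity_degree _ =
     (1 / (real CARD('a))\<^sup>2) * (\<Sum>r\<in>(UNIV :: 'a set). real (card (centralizer r)))"

end

theory Submission
  imports Defs
begin

text \<open>
  Write \<open>Z\<close> for the centre and let \<open>r\<close> be a noncentral element. Then \<open>Z \<subset> C(r) \<subset> R\<close> is a strict
  chain of additive subgroups, because \<open>r\<close> itself lies in \<open>C(r)\<close> but not in \<open>Z\<close>. By Lagrange both
  indices are divisors of \<open>|R|\<close> greater than 1, hence at least \<open>p\<close>. So \<open>|C(r)| \<le> |R|/p\<close> and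
  \<open>p\<^sup>2 |Z| \<le> |R|\<close>. The first bound gives
  \<open>d(R) \<le> |Z|/|R| + (1 - |Z|/|R|)/p\<close>, and the right-hand side reaches \<open>(p\<^sup>2 + p - 1)/p\<^sup>3\<close> only if
  \<open>|R| \<le> p\<^sup>2 |Z|\<close>. The hypothesis on \<open>d(R)\<close> therefore forces equality throughout: \<open>|R| = p\<^sup>2 |Z|\<close> and
  \<open>|C(r)| = p |Z|\<close> for every noncentral \<open>r\<close> (lemma \<open>card_centralizer_extremal\<close>).

  Since \<open>C(r)\<close> has prime index over \<open>Z\<close>, it is commutative: its own centre contains \<open>Z\<close>
  and \<open>r\<close>, which leaves only \<open>C(r)\<close>. Hence a noncentral \<open>t \<in> C(r)\<close> satisfies \<open>C(r) \<subseteq> C(t)\<close>, and the two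
  have the same size, so \<open>C(t) = C(r)\<close>. Thus the sets \<open>C(r) - Z\<close> partition \<open>R - Z\<close> into blocks of
  size \<open>(p - 1) |Z|\<close>, of which there are \<open>(p\<^sup>2 - 1)/(p - 1) = p + 1\<close>. The centralizer \<open>R\<close> of the
  central elements is the remaining one.
\<close>

section \<open>Additive subgroups\<close>

definition additive_subgroup :: "'a::ab_group_add set \<Rightarrow> bool" where
  "additive_subgroup H \<longleftrightarrow> 0 \<in> H \<and> (\<forall>x\<in>H. \<forall>y\<in>H. x - y \<in> H)"

lemma additive_subgroupD:
  assumes "additive_subgroup H"
  shows "0 \<in> H" and "x \<in> H \<Longrightarrow> y \<in> H \<Longrightarrow> x - y \<in> H"
    and "x \<in> H \<Longrightarrow> - x \<in> H" and "x \<in> H \<Longrightarrow> y \<in> H \<Longrightarrow> x + y \<in> H"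
proof -
  show zero: "0 \<in> H" and diff: "\<And>x y. x \<in> H \<Longrightarrow> y \<in> H \<Longrightarrow> x - y \<in> H"
    using assms by (auto simp: additive_subgroup_def)
  show neg: "- x \<in> H" if "x \<in> H" for x
    using diff[OF zero that] by simp
  show "x + y \<in> H" if "x \<in> H" "y \<in> H"
    using diff[OF that(1) neg[OF that(2)]] by simp
qed

text \<open>Lagrange's theorem: \<open>K\<close> splits into cosets of \<open>H\<close>, each a translate of \<open>H\<close>.\<close>

lemma card_additive_subgroup_dvd:
  fixes H K :: "'a::{ab_group_add, finite} set"
  assumes H: "additive_subgroup H" and K: "additive_subgroup K" and HK: "H \<subseteq> K"
  shows "card H dvd card K"
proof -
  define E where "E = {(x, y). x \<in> K \<and> y \<in> K \<and> y - x \<in> H}"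
  have "equiv K E"
  proof (rule equivI)
    show "E \<subseteq> K \<times> K" "refl_on K E"
      using additive_subgroupD(1)[OF H] by (auto simp: E_def refl_on_def)
    show "sym E"
      using additive_subgroupD(3)[OF H] by (fastforce simp: E_def intro!: symI)
    show "trans E"
    proof (rule transI)
      fix x y z assume "(x, y) \<in> E" "(y, z) \<in> E"
      then show "(x, z) \<in> E"
        using additive_subgroupD(4)[OF H, of "z - y" "y - x"] by (auto simp: E_def)
    qed
  qed
  moreover have "card H dvd card X" if X: "X \<in> K // E" for X
  proof -
    obtain x where x: "x \<in> K" "X = E `` {x}"
      using X by (rule quotientE)
    have "E `` {x} = (+) x ` H"
    proof (rule equalityI; rule subsetI)
      fix y assume "y \<in> E `` {x}"
      then have "y - x \<in> H" by (auto simp: E_def)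
      then show "y \<in> (+) x ` H" by (intro image_eqI[of _ _ "y - x"]) auto
    next
      fix y assume "y \<in> (+) x ` H"
      then show "y \<in> E `` {x}"
        using x(1) HK additive_subgroupD(4)[OF K] by (auto simp: E_def)
    qed
    then show ?thesis using x(2) by (simp add: card_image)
  qed
  ultimately show ?thesis
    by (intro equiv_imp_dvd_card[of K E]) auto
qed

lemma least_prime_le_divisor:
  fixes n p m :: nat
  assumes "\<forall>q. prime q \<longrightarrow> q dvd n \<longrightarrow> p \<le> q" and "m dvd n" and "m > 1"
  shows "p \<le> m"
proof -
  obtain q where q: "prime q" "q dvd m"
    using prime_factor_nat[of m] assms(3) by auto
  then have "p \<le> q" using assms(1,2) dvd_trans by blast
  also have "q \<le> m" using q(2) assms(3) by (simp add: dvd_imp_le)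
  finally show ?thesis .
qed

text \<open>The index of a proper subgroup is a divisor of \<open>CARD('a)\<close> other than 1, hence at least \<open>p\<close>.\<close>

lemma card_proper_additive_subgroup:
  fixes H K :: "'a::{ab_group_add, finite} set"
  assumes p_least: "\<forall>q. prime q \<longrightarrow> q dvd CARD('a) \<longrightarrow> p \<le> q"
    and H: "additive_subgroup H" and K: "additive_subgroup K" and HK: "H \<subset> K"
  shows "p * card H \<le> card K"
proof -
  obtain m where m: "card K = card H * m"
    using card_additive_subgroup_dvd[OF H K] HK by (auto elim: dvdE)
  have less: "card H < card K" using HK by (simp add: psubset_card_mono)
  have "m > 1" using less m by (cases m) auto
  moreover have "m dvd CARD('a)"
  proof -
    have "card K dvd CARD('a)"
      by (rule card_additive_subgroup_dvd[OF K]) (auto simp: additive_subgroup_def)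
    then show ?thesis using m by (auto intro: dvd_trans[of m "card K"])
  qed
  ultimately have "p \<le> m" using least_prime_le_divisor p_least by blast
  then show ?thesis using m by simp
qed

section \<open>Centralizers and the centre\<close>

definition centre :: "'a::ring set" where
  "centre = {z. \<forall>s. z * s = s * z}"

lemma additive_subgroup_centralizer: "additive_subgroup (centralizer r)"
  by (auto simp: additive_subgroup_def centralizer_def algebra_simps)

lemma additive_subgroup_centre: "additive_subgroup centre"
  by (auto simp: additive_subgroup_def centre_def algebra_simps)

lemma self_in_centralizer: "r \<in> centralizer r"
  by (simp add: centralizer_def)

lemma centre_subset_centralizer: "centre \<subseteq> centralizer r"
  by (auto simp: centralizer_def centre_def)

lemma centralizer_eq_UNIV_iff: "centralizer r = UNIV \<longleftrightarrow> r \<in> centre"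
  by (auto simp: centralizer_def centre_def)

lemma centre_psubset_centralizer: "r \<notin> centre \<Longrightarrow> centre \<subset> centralizer r"
  using centre_subset_centralizer self_in_centralizer by blast

text \<open>
  The centre \<open>D\<close> of \<open>C(r)\<close> strictly contains \<open>Z\<close>, because it contains \<open>r\<close>. As \<open>p\<close> bounds the index
  of every strict inclusion from below, \<open>D\<close> already has \<open>p |Z| = |C(r)|\<close> elements.
\<close>

lemma centralizer_commutative:
  fixes r :: "'a::{ring, finite}"
  assumes p_least: "\<forall>q. prime q \<longrightarrow> q dvd CARD('a) \<longrightarrow> p \<le> q" and p: "p > 1"
    and r: "r \<notin> centre" and card_r: "card (centralizer r) = p * card (centre :: 'a set)"
    and s: "s \<in> centralizer r" and t: "t \<in> centralizer r"
  shows "s * t = t * s"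
proof -
  define D where "D = {d \<in> centralizer r. \<forall>c\<in>centralizer r. d * c = c * d}"
  have D: "additive_subgroup D"
    using additive_subgroupD[OF additive_subgroup_centralizer[of r]]
    by (auto simp: additive_subgroup_def D_def algebra_simps)
  have "r \<in> D" by (auto simp: D_def centralizer_def)
  moreover have "centre \<subseteq> D" by (auto simp: D_def centre_def centralizer_def)
  ultimately have "centre \<subset> D" using r by blast
  then have "p * card (centre :: 'a set) \<le> card D"
    by (rule card_proper_additive_subgroup[OF p_least additive_subgroup_centre D])
  moreover have "D \<subseteq> centralizer r" by (auto simp: D_def)
  ultimately have "D = centralizer r"
    using card_r by (intro card_seteq) auto
  then show ?thesis using s t by (auto simp: D_def)
qed

section \<open>The extremal commutativity degree\<close>

text \<open>
  The given degree is the value that the bound \<open>p |C(r)| \<le> |R|\<close> for noncentral \<open>r\<close> would produce if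
  \<open>|R| = p\<^sup>2 |Z|\<close>; a larger index of \<open>Z\<close> would leave too few commuting pairs.
\<close>

lemma card_centralizer_extremal:
  fixes p :: nat and r :: "'a::{ring, finite}"
  assumes p_least: "\<forall>q. prime q \<longrightarrow> q dvd CARD('a) \<longrightarrow> p \<le> q" and p: "p > 1"
    and degree: "commutativity_degree TYPE('a) = (1 / real p ^ 3) * ((real p)\<^sup>2 + real p - 1)"
    and r: "r \<notin> centre"
  shows "card (centralizer r) = p * card (centre :: 'a set)"
    and "CARD('a) = p\<^sup>2 * card (centre :: 'a set)"
proof -
  define n where "n = CARD('a)"
  define z where "z = card (centre :: 'a set)"
  define S where "S = (\<Sum>x\<in>(UNIV :: 'a set). real (card (centralizer x)))"
  have n: "n > 0" by (simp add: n_def)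
  have upper: "p * card (centralizer x) \<le> n" if "x \<notin> centre" for x :: 'a
    unfolding n_def
  proof (rule card_proper_additive_subgroup[OF p_least additive_subgroup_centralizer])
    show "additive_subgroup (UNIV :: 'a set)" by (simp add: additive_subgroup_def)
    show "centralizer x \<subset> UNIV" using that by (simp add: psubset_eq centralizer_eq_UNIV_iff)
  qed
  have "real p * S = (\<Sum>x\<in>(UNIV :: 'a set). real p * real (card (centralizer x)))"
    by (simp add: S_def sum_distrib_left)
  also have "\<dots> \<le> (\<Sum>x\<in>(UNIV :: 'a set). if x \<in> centre then real p * real n else real n)"
  proof (rule sum_mono)
    fix x :: 'a
    show "real p * real (card (centralizer x)) \<le> (if x \<in> centre then real p * real n else real n)"
    proof (cases "x \<in> centre")
      case True
      then have "centralizer x = UNIV" by (simp add: centralizer_eq_UNIV_iff)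
      then show ?thesis using True by (simp add: n_def)
    next
      case False
      then show ?thesis using upper[OF False] by (simp flip: of_nat_mult)
    qed
  qed
  also have "\<dots> = real z * (real p * real n) + (real n - real z) * real n"
  proof -
    have "real (card (- centre :: 'a set)) = real n - real z"
      using card_mono[of UNIV "centre :: 'a set"]
      by (simp add: Compl_eq_Diff_UNIV card_Diff_subset n_def z_def of_nat_diff)
    then show ?thesis by (simp add: sum.If_cases z_def)
  qed
  finally have S_le: "real p * S \<le> real n * (real z * real p + real n - real z)"
    by (simp add: algebra_simps)
  have "S = (real n)\<^sup>2 * ((1 / real p ^ 3) * ((real p)\<^sup>2 + real p - 1))"
    using degree n by (simp add: commutativity_degree_def S_def n_def field_simps)
  then have "(real p)\<^sup>2 * (real p * S) = real n * (real n * ((real p)\<^sup>2 + real p - 1))"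
    using p by (simp add: field_simps power2_eq_square power3_eq_cube)
  moreover have "(real p)\<^sup>2 * (real p * S)
      \<le> (real p)\<^sup>2 * (real n * (real z * real p + real n - real z))"
    using S_le by (intro mult_left_mono) auto
  ultimately have "real n * (real n * ((real p)\<^sup>2 + real p - 1))
      \<le> real n * ((real p)\<^sup>2 * (real z * real p + real n - real z))"
    by (simp add: algebra_simps)
  then have "real n * ((real p)\<^sup>2 + real p - 1) \<le> (real p)\<^sup>2 * (real z * real p + real n - real z)"
    using n by simp
  then have "(real p - 1) * real n \<le> (real p - 1) * ((real p)\<^sup>2 * real z)"
    by (simp add: algebra_simps)
  then have "real n \<le> (real p)\<^sup>2 * real z"
    using p by simp
  then have n_le: "n \<le> p * (p * z)"
    by (simp add: power2_eq_square mult.assoc flip: of_nat_mult)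
  have lower: "p * z \<le> card (centralizer r)"
    unfolding z_def using r
    by (intro card_proper_additive_subgroup[OF p_least additive_subgroup_centre
          additive_subgroup_centralizer] centre_psubset_centralizer)
  then have "p * (p * z) \<le> p * card (centralizer r)" by simp
  with upper[OF r] n_le have eq: "p * card (centralizer r) = p * (p * z)" "n = p * (p * z)"
    by linarith+
  show "card (centralizer r) = p * card (centre :: 'a set)"
    using eq(1) p by (simp add: z_def)
  show "CARD('a) = p\<^sup>2 * card (centre :: 'a set)"
    using eq(2) by (simp add: n_def z_def power2_eq_square)
qed

theorem proposition5p3:
  fixes p :: nat
  assumes noncomm: "\<exists>x y :: 'a::{ring, finite}. x * y \<noteq> y * x"
    and prime_p: "prime p"
    and p_dvd: "p dvd CARD('a)"
    and p_least: "\<And>q. prime q \<Longrightarrow> q dvd CARD('a) \<Longrightarrow> p \<le> q"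
    and degree: "commutativity_degree TYPE('a) = (1 / real p ^ 3) * ((real p)\<^sup>2 + real p - 1)"
  shows "card (Cent TYPE('a)) = p + 2"
proof -
  define Z where "Z = (centre :: 'a set)"
  define F where "F = centralizer ` (- Z)"
  have least: "\<forall>q. prime q \<longrightarrow> q dvd CARD('a) \<longrightarrow> p \<le> q"
    using p_least by blast
  have p: "p > 1" using prime_p by (rule prime_gt_1_nat)
  obtain r\<^sub>0 :: 'a where r\<^sub>0: "r\<^sub>0 \<notin> centre"
    using noncomm by (auto simp: centre_def)
  note card_r = card_centralizer_extremal(1)[OF least p degree]
  note card_R = card_centralizer_extremal(2)[OF least p degree r\<^sub>0]
  have Z_pos: "card Z > 0"
    using additive_subgroupD(1)[OF additive_subgroup_centre] by (auto simp: Z_def card_gt_0_iff)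
  have centralizer_eq: "centralizer t = centralizer r"
    if r: "r \<notin> centre" and t: "t \<notin> centre" "t \<in> centralizer r" for r t :: 'a
  proof -
    have "centralizer r \<subseteq> centralizer t"
      using centralizer_commutative[OF least p r card_r[OF r] t(2)]
      by (auto simp: centralizer_def)
    then show ?thesis
      using card_r[OF r] card_r[OF t(1)] by (intro card_seteq[symmetric]) auto
  qed
  \<comment> \<open>Removing the centre turns the centralizers of noncentral elements into disjoint blocks.\<close>
  have "card (\<Union>A\<in>F. A - Z) = (\<Sum>A\<in>F. card (A - Z))"
  proof (rule card_UN_disjoint)
    show "\<forall>A\<in>F. \<forall>B\<in>F. A \<noteq> B \<longrightarrow> (A - Z) \<inter> (B - Z) = {}"
    proof (intro ballI impI)
      fix A B assume "A \<in> F" "B \<in> F" "A \<noteq> B"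
      then obtain r s where rs: "r \<notin> centre" "A = centralizer r" "s \<notin> centre" "B = centralizer s"
        by (auto simp: F_def Z_def)
      have False if t: "t \<in> A" "t \<in> B" "t \<notin> centre" for t
        using centralizer_eq[OF rs(1) t(3)] centralizer_eq[OF rs(3) t(3)] rs(2,4) t(1,2) \<open>A \<noteq> B\<close>
        by simp
      then show "(A - Z) \<inter> (B - Z) = {}" by (auto simp: Z_def)
    qed
  qed auto
  also have "\<dots> = (\<Sum>A\<in>F. (p - 1) * card Z)"
  proof (rule sum.cong[OF refl])
    fix A assume "A \<in> F"
    then obtain r where r: "r \<notin> centre" "A = centralizer r" by (auto simp: F_def Z_def)
    then show "card (A - Z) = (p - 1) * card Z"
      using card_r[OF r(1)] centre_subset_centralizer[of r]
      by (simp add: card_Diff_subset Z_def diff_mult_distrib)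
  qed
  finally have "card (\<Union>A\<in>F. A - Z) = card F * ((p - 1) * card Z)" by simp
  moreover have "(\<Union>A\<in>F. A - Z) = - Z"
    using self_in_centralizer by (auto simp: F_def)
  moreover have "card (- Z) = (p + 1) * ((p - 1) * card Z)"
  proof -
    have "card (- Z) = p\<^sup>2 * card Z - card Z" using card_R by (simp add: Compl_eq_Diff_UNIV card_Diff_subset Z_def)
    also have "\<dots> = (p + 1) * ((p - 1) * card Z)"
      using p by (cases p) (auto simp: power2_eq_square algebra_simps)
    finally show ?thesis .
  qed
  ultimately have "card F * ((p - 1) * card Z) = (p + 1) * ((p - 1) * card Z)" by metis
  then have "card F = p + 1" using p Z_pos by (simp only: mult_cancel2) auto
  moreover have "Cent TYPE('a) = insert UNIV F"
  proof -
    have "range centralizer = centralizer ` Z \<union> F" by (auto simp: F_def)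
    moreover have "centralizer ` Z = {UNIV}"
      using Z_pos centralizer_eq_UNIV_iff by (auto simp: Z_def card_gt_0_iff)
    ultimately show ?thesis by (simp add: Cent_def)
  qed
  moreover have "UNIV \<notin> F"
    using centralizer_eq_UNIV_iff by (fastforce simp: F_def Z_def)
  ultimately show ?thesis by simp
qed

end
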